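(* Let $(\sigma_k)_{k\in\mathbb{N}_0}\in\{\pm1\}^{\mathbb{N}_0}$ be an arbitrary sequence of signs, and define polynomials $P_k,Q_k$ ($k\in\mathbb{N}_0$) by $P_0(x)=Q_0(x)=x$ and $$P_{k+1}(x)=P_k(x)+\sigma_k\,x^{2^k}Q_k(x),\qquad Q_{k+1}(x)=P_k(x)-\sigma_k\,x^{2^k}Q_k(x).$$ Let $(\varepsilon_n)_{n\in\mathbb{N}}\in\{\pm1\}^{\mathbb{N}}$ be the sequence determined by $P_k(x)=\sum_{n=1}^{2^k}\varepsilon_n x^n$ for all $k\in\mathbb{N}_0$. Then $(\varepsilon_n)_{n\in\mathbb{N}}$ has the root-$N$ property: there is a constant $C>0$ such that for all integers $N\ge1$, $$\sup_{x\in\mathbb{C},\,|x|=1}\left|\sum_{n=1}^{N}\varepsilon_n x^n\right|\le C\,N^{1/2}.$$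
   Context: $\mathbb{N}=\{1,2,3,\dots\}$ and $\mathbb{N}_0=\mathbb{N}\cup\{0\}$. The sequence $(\varepsilon_n)$ is well defined because the terms of $P_{k+1}$ of degree at most $2^k$ coincide with those of $P_k$. *)

theory Defs
  imports Complex_Main "HOL-Computational_Algebra.Polynomial"
begin

fun rs_P :: "(nat \<Rightarrow> int) \<Rightarrow> nat \<Rightarrow> int poly"
  and rs_Q :: "(nat \<Rightarrow> int) \<Rightarrow> nat \<Rightarrow> int poly"
where
  "rs_P \<sigma> 0 = [:0, 1:]"
| "rs_Q \<sigma> 0 = [:0, 1:]"
| "rs_P \<sigma> (Suc k) = rs_P \<sigma> k + smult (\<sigma> k) (monom 1 (2 ^ k) * rs_Q \<sigma> k)"
| "rs_Q \<sigma> (Suc k) = rs_P \<sigma> k - smult (\<sigma> k) (monom 1 (2 ^ k) * rs_Q \<sigma> k)"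

text \<open>Sequences indexed by the positive integers are functions on \<open>nat\<close> whose value at 0 is
  irrelevant.\<close>

definition rs_sign_seq :: "(nat \<Rightarrow> int) \<Rightarrow> (nat \<Rightarrow> int) \<Rightarrow> bool" where
  "rs_sign_seq \<sigma> \<epsilon> \<longleftrightarrow>
     (\<forall>n\<ge>1. \<epsilon> n \<in> {1, -1}) \<and>
     (\<forall>k. rs_P \<sigma> k = (\<Sum>n=1..2 ^ k. monom (\<epsilon> n) n))"

text \<open>The supremum is that of a nonempty set of reals bounded above by the sum of the
  \<open>\<bar>\<epsilon> n\<bar>\<close>, so it is a genuine least upper bound.\<close>

definition root_N_property :: "(nat \<Rightarrow> int) \<Rightarrow> bool" where
  "root_N_property \<epsilon> \<longleftrightarrow>
     (\<exists>C>0. \<forall>N\<ge>1.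
        (SUP x\<in>{x :: complex. norm x = 1}. norm (\<Sum>n=1..N. of_int (\<epsilon> n) * x ^ n))
          \<le> C * sqrt (real N))"

lemma rs_coeff_support:
  assumes "n = 0 \<or> 2 ^ k < n"
  shows "coeff (rs_P \<sigma> k) n = 0 \<and> coeff (rs_Q \<sigma> k) n = 0"
  using assms
proof (induction k arbitrary: n)
  case 0
  then show ?case
    by (auto simp: coeff_pCons split: nat.splits)
next
  case (Suc k)
  then have "n = 0 \<or> 2 ^ k < n" and "n < 2 ^ k \<or> 2 ^ k < n - 2 ^ k"
    by auto
  with Suc.IH[of n] Suc.IH[of "n - 2 ^ k"] show ?case
    by (auto simp: coeff_monom_mult)
qed

lemma rs_coeff_sign:
  assumes "\<forall>j. \<sigma> j \<in> {1, -1}" and "1 \<le> n" and "n \<le> 2 ^ k"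
  shows "coeff (rs_P \<sigma> k) n \<in> {1, -1} \<and> coeff (rs_Q \<sigma> k) n \<in> {1, -1}"
  using assms(2,3)
proof (induction k arbitrary: n)
  case 0
  then have "n = 1" by simp
  then show ?case by simp
next
  case (Suc k)
  have s: "\<sigma> k = 1 \<or> \<sigma> k = -1" using assms(1) by auto
  show ?case
  proof (cases "n \<le> 2 ^ k")
    case True
    then have "coeff (monom 1 (2 ^ k) * rs_Q \<sigma> k) n = 0"
      using rs_coeff_support[of 0 k \<sigma>] by (auto simp: coeff_monom_mult)
    with Suc.IH[OF Suc.prems(1) True] show ?thesis by simp
  next
    case False
    then have "coeff (rs_P \<sigma> k) n = 0"
      using rs_coeff_support[of n k \<sigma>] by simp
    moreover have "1 \<le> n - 2 ^ k" "n - 2 ^ k \<le> 2 ^ k"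
      using False Suc.prems by auto
    ultimately show ?thesis
      using Suc.IH[of "n - 2 ^ k"] False s by (auto simp: coeff_monom_mult)
  qed
qed

lemma rs_coeff_stable:
  assumes "n \<le> 2 ^ k" and "k \<le> m"
  shows "coeff (rs_P \<sigma> m) n = coeff (rs_P \<sigma> k) n"
  using assms(2)
proof (induction m rule: dec_induct)
  case base
  show ?case ..
next
  case (step m)
  have "n \<le> 2 ^ m"
    using assms(1) step.hyps(1) by (meson le_trans one_le_numeral power_increasing)
  then have "coeff (monom 1 (2 ^ m) * rs_Q \<sigma> m) n = 0"
    using rs_coeff_support[of 0 m \<sigma>] by (auto simp: coeff_monom_mult)
  with step.IH show ?case by simp
qed

lemma rs_sign_seq_exists:
  assumes "\<forall>j. \<sigma> j \<in> {1, -1}"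
  shows "\<exists>\<epsilon>. rs_sign_seq \<sigma> \<epsilon>"
proof
  let ?e = "\<lambda>n. coeff (rs_P \<sigma> n) n"
  have le: "n \<le> 2 ^ n" for n :: nat by (simp add: less_imp_le)
  have "rs_P \<sigma> k = (\<Sum>n=1..2 ^ k. monom (?e n) n)" for k
  proof (rule poly_eqI)
    fix n
    have eq: "?e n = coeff (rs_P \<sigma> k) n" if "n \<le> 2 ^ k"
      using rs_coeff_stable[OF le, of n k \<sigma>] rs_coeff_stable[OF that, of n \<sigma>]
      by (cases "n \<le> k") auto
    have "coeff (\<Sum>i=1..2 ^ k. monom (?e i) i) n = (if n \<in> {1..2 ^ k} then ?e n else 0)"
      by (simp add: coeff_sum)
    then show "coeff (rs_P \<sigma> k) n = coeff (\<Sum>i=1..2 ^ k. monom (?e i) i) n"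
      using eq rs_coeff_support[of n k \<sigma>] by (cases "n = 0") auto
  qed
  moreover have "\<forall>n\<ge>1. ?e n \<in> {1, -1}"
    using rs_coeff_sign[OF assms _ le] by blast
  ultimately show "rs_sign_seq \<sigma> ?e"
    unfolding rs_sign_seq_def by blast
qed

lemma rs_sign_seq_unique:
  assumes "rs_sign_seq \<sigma> \<epsilon>" and "1 \<le> n"
  shows "\<epsilon> n = coeff (rs_P \<sigma> n) n"
proof -
  have "n \<le> 2 ^ n" by (simp add: less_imp_le)
  moreover have "rs_P \<sigma> n = (\<Sum>i=1..2 ^ n. monom (\<epsilon> i) i)"
    using assms(1) by (simp add: rs_sign_seq_def)
  ultimately show ?thesis using assms(2) by (simp add: coeff_sum)
qed

end

theory Submission
  imports Defs
begin

text \<open>On the unit circle, \<open>P\<^sub>k\<^sub>+\<^sub>1\<close> and \<open>Q\<^sub>k\<^sub>+\<^sub>1\<close> are the sum and the difference of two numbers of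
  modulus \<open>\<bar>P\<^sub>k\<bar>\<close> and \<open>\<bar>Q\<^sub>k\<bar>\<close>, so the parallelogram law gives
  \<open>\<bar>P\<^sub>k\<bar>\<^sup>2 + \<bar>Q\<^sub>k\<bar>\<^sup>2 = 2 \<cdot> 2 ^ k\<close>, whatever the signs (\<open>rs_norm_sum\<close>). In particular \<open>\<bar>P\<^sub>k\<bar>\<close> is
  at most \<open>sqrt 2\<close> times the square root of the number \<open>2 ^ k\<close> of its terms, which is the root-\<open>N\<close>
  property along powers of 2.

  For the other values of \<open>N\<close>, the first \<open>N\<close> terms of \<open>P\<^sub>k\<^sub>+\<^sub>1\<close> with \<open>2 ^ k < N \<le> 2 ^ (k + 1)\<close> are
  all of \<open>P\<^sub>k\<close>, followed by a shifted copy of the first \<open>N - 2 ^ k\<close> terms of \<open>\<plusminus>Q\<^sub>k\<close>; the same is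
  true of \<open>Q\<^sub>k\<^sub>+\<^sub>1\<close>. Bounding the first part by \<open>sqrt (2 \<cdot> 2 ^ k)\<close> and the second by an induction
  that treats \<open>P\<^sub>k\<close> and \<open>Q\<^sub>k\<close> together, a bound \<open>C sqrt N\<close> is inherited as soon as
  \<open>sqrt (2 a) + C sqrt b \<le> C sqrt (a + b)\<close> for \<open>b \<le> a\<close>. The increment
  \<open>sqrt (a + b) - sqrt b\<close> decreases in \<open>b\<close>, so \<open>b = a\<close> is the worst case and
  \<open>C = sqrt 2 / (sqrt 2 - 1) = 2 + sqrt 2\<close> is the least admissible constant
  (\<open>sqrt_step\<close>, \<open>rs_truncation_bound\<close>).\<close>

definition truncated_eval :: "int poly \<Rightarrow> nat \<Rightarrow> complex \<Rightarrow> complex" where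
  "truncated_eval p N x = (\<Sum>n\<le>N. of_int (coeff p n) * x ^ n)"

lemma truncated_eval_add:
  "truncated_eval (p + q) N x = truncated_eval p N x + truncated_eval q N x"
  by (simp add: truncated_eval_def sum.distrib distrib_right)

lemma truncated_eval_diff:
  "truncated_eval (p - q) N x = truncated_eval p N x - truncated_eval q N x"
  by (simp add: truncated_eval_def sum_subtractf left_diff_distrib)

lemma truncated_eval_smult:
  "truncated_eval (smult c p) N x = of_int c * truncated_eval p N x"
  by (simp add: truncated_eval_def sum_distrib_left mult.assoc)

lemma truncated_eval_monom_mult:
  "truncated_eval (monom 1 d * q) N x = (if N < d then 0 else x ^ d * truncated_eval q (N - d) x)"
proof (cases "N < d")
  case True
  then show ?thesis
    by (auto simp: truncated_eval_def coeff_monom_mult intro!: sum.neutral)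
next
  case False
  have "truncated_eval (monom 1 d * q) N x
      = (\<Sum>n\<in>{d..N}. of_int (coeff q (n - d)) * x ^ n)"
    unfolding truncated_eval_def
    by (rule sum.mono_neutral_cong_right) (auto simp: coeff_monom_mult)
  also have "\<dots> = (\<Sum>n\<le>N - d. x ^ d * (of_int (coeff q n) * x ^ n))"
    using False
    by (intro sum.reindex_bij_witness[where i = "\<lambda>n. n + d" and j = "\<lambda>n. n - d"])
      (auto simp flip: power_add)
  also have "\<dots> = x ^ d * truncated_eval q (N - d) x"
    by (simp add: truncated_eval_def sum_distrib_left)
  finally show ?thesis
    using False by simp
qed

lemma truncated_eval_rs_complete:
  assumes "2 ^ k \<le> N"
  shows "truncated_eval (rs_P \<sigma> k) N x = truncated_eval (rs_P \<sigma> k) (2 ^ k) x"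
    and "truncated_eval (rs_Q \<sigma> k) N x = truncated_eval (rs_Q \<sigma> k) (2 ^ k) x"
proof -
  have "coeff (rs_P \<sigma> k) n = 0 \<and> coeff (rs_Q \<sigma> k) n = 0" if "n \<in> {..N} - {..2 ^ k}" for n
    using that by (intro rs_coeff_support) auto
  then show "truncated_eval (rs_P \<sigma> k) N x = truncated_eval (rs_P \<sigma> k) (2 ^ k) x"
    and "truncated_eval (rs_Q \<sigma> k) N x = truncated_eval (rs_Q \<sigma> k) (2 ^ k) x"
    unfolding truncated_eval_def using assms by (intro sum.mono_neutral_right; simp)+
qed

lemma truncated_eval_rs_0:
  "truncated_eval (rs_P \<sigma> k) 0 x = 0" "truncated_eval (rs_Q \<sigma> k) 0 x = 0"
  using rs_coeff_support[of 0 k \<sigma>] by (auto simp: truncated_eval_def)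

lemma truncated_eval_rs_Suc_low:
  assumes "N \<le> 2 ^ k"
  shows "truncated_eval (rs_P \<sigma> (Suc k)) N x = truncated_eval (rs_P \<sigma> k) N x"
    and "truncated_eval (rs_Q \<sigma> (Suc k)) N x = truncated_eval (rs_P \<sigma> k) N x"
  using assms
  by (auto simp: truncated_eval_add truncated_eval_diff truncated_eval_smult
      truncated_eval_monom_mult truncated_eval_rs_0)

lemma truncated_eval_rs_Suc_high:
  assumes "2 ^ k \<le> N"
  shows "truncated_eval (rs_P \<sigma> (Suc k)) N x = truncated_eval (rs_P \<sigma> k) (2 ^ k) x
      + of_int (\<sigma> k) * x ^ 2 ^ k * truncated_eval (rs_Q \<sigma> k) (N - 2 ^ k) x"
    and "truncated_eval (rs_Q \<sigma> (Suc k)) N x = truncated_eval (rs_P \<sigma> k) (2 ^ k) x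
      - of_int (\<sigma> k) * x ^ 2 ^ k * truncated_eval (rs_Q \<sigma> k) (N - 2 ^ k) x"
  using assms truncated_eval_rs_complete[OF assms]
  by (auto simp: truncated_eval_add truncated_eval_diff truncated_eval_smult
      truncated_eval_monom_mult mult.assoc)

lemma complex_parallelogram_law:
  "(cmod (a + b))\<^sup>2 + (cmod (a - b))\<^sup>2 = 2 * ((cmod a)\<^sup>2 + (cmod b)\<^sup>2)"
  unfolding cmod_power2 by (simp add: power2_eq_square algebra_simps)

lemma norm_sign_power:
  fixes x :: complex
  assumes "s \<in> {1, -1}" and "norm x = 1"
  shows "norm (of_int s * x ^ d * z) = norm z"
  using assms by (auto simp: norm_mult norm_power)

text \<open>Multiplying \<open>Q\<^sub>k\<close> by \<open>\<sigma>\<^sub>k x ^ (2 ^ k)\<close> preserves its modulus on the unit circle, so each step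
  of the recursion doubles the sum of squares by the parallelogram law.\<close>

lemma rs_norm_sum:
  assumes "\<forall>k. \<sigma> k \<in> {1, -1}" and "norm x = 1"
  shows "(norm (truncated_eval (rs_P \<sigma> k) (2 ^ k) x))\<^sup>2
    + (norm (truncated_eval (rs_Q \<sigma> k) (2 ^ k) x))\<^sup>2 = 2 * 2 ^ k"
proof (induction k)
  case 0
  show ?case
    using assms(2) by (simp add: truncated_eval_def)
next
  case (Suc k)
  have "(2::nat) ^ k \<le> 2 ^ Suc k" "(2::nat) ^ Suc k - 2 ^ k = 2 ^ k"
    by simp_all
  moreover have "\<sigma> k \<in> {1, -1}"
    using assms(1) by blast
  ultimately show ?case
    using Suc.IH assms(2)
    by (simp only: truncated_eval_rs_Suc_high complex_parallelogram_law norm_sign_power) simp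
qed

lemma rs_P_complete_bound:
  assumes "\<forall>k. \<sigma> k \<in> {1, -1}" and "norm x = 1"
  shows "norm (truncated_eval (rs_P \<sigma> k) (2 ^ k) x) \<le> sqrt 2 * sqrt (2 ^ k)"
  unfolding real_sqrt_mult[symmetric]
  using rs_norm_sum[OF assms, of k]
    zero_le_power2[of "norm (truncated_eval (rs_Q \<sigma> k) (2 ^ k) x)"]
  by (intro real_le_rsqrt) linarith

lemma sqrt_step:
  fixes a b :: real
  assumes "0 \<le> b" and "b \<le> a"
  shows "sqrt 2 * sqrt a + (2 + sqrt 2) * sqrt b \<le> (2 + sqrt 2) * sqrt (a + b)"
proof (rule power2_le_imp_le)
  define u v r where "u = sqrt a" and "v = sqrt b" and "r = sqrt (2::real)"
  have sq: "u\<^sup>2 = a" "v\<^sup>2 = b" "r\<^sup>2 = 2" "(sqrt (a + b))\<^sup>2 = a + b"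
    using assms by (simp_all add: u_def v_def r_def)
  have "0 \<le> r" "0 \<le> u" "v \<le> u"
    using assms by (simp_all add: u_def v_def r_def)
  then have "0 \<le> (4 + 4 * r) * (u * (u - v))"
    by simp
  \<comment> \<open>Because \<open>r\<^sup>2 = 2\<close>, this is exactly the difference of the squares of the two sides.\<close>
  also have "\<dots> = (4 + 4 * r) * u\<^sup>2 - (4 * r + 2 * r\<^sup>2) * (u * v)"
    unfolding sq(3) by (simp add: power2_eq_square algebra_simps)
  also have "\<dots> = (2 + r)\<^sup>2 * (u\<^sup>2 + v\<^sup>2) - (r * u + (2 + r) * v)\<^sup>2"
    by (simp add: power2_eq_square algebra_simps)
  finally show "(sqrt 2 * sqrt a + (2 + sqrt 2) * sqrt b)\<^sup>2 \<le> ((2 + sqrt 2) * sqrt (a + b))\<^sup>2"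
    using sq by (simp add: power_mult_distrib flip: u_def v_def r_def)
  show "0 \<le> (2 + sqrt 2) * sqrt (a + b)"
    using assms by simp
qed

text \<open>The bound must be carried for \<open>P\<^sub>k\<close> and \<open>Q\<^sub>k\<close> at once, since the second half of \<open>P\<^sub>k\<^sub>+\<^sub>1\<close> is
  made of \<open>Q\<^sub>k\<close>. Only its first half, which is taken in full, uses the estimate for complete
  polynomials.\<close>

lemma rs_truncation_bound:
  assumes "\<forall>k. \<sigma> k \<in> {1, -1}" and "norm x = 1" and "N \<le> 2 ^ k"
  shows "norm (truncated_eval (rs_P \<sigma> k) N x) \<le> (2 + sqrt 2) * sqrt N
    \<and> norm (truncated_eval (rs_Q \<sigma> k) N x) \<le> (2 + sqrt 2) * sqrt N"
  using assms(3)
proof (induction k arbitrary: N)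
  case 0
  then consider "N = 0" | "N = 1"
    by fastforce
  then show ?case
    using assms(2) by cases (simp_all add: truncated_eval_def)
next
  case (Suc k)
  show ?case
  proof (cases "N \<le> 2 ^ k")
    case True
    then show ?thesis
      using Suc.IH[OF True] by (simp only: truncated_eval_rs_Suc_low)
  next
    case False
    define M where "M = N - 2 ^ k"
    have M: "N = 2 ^ k + M" "M \<le> 2 ^ k"
      using False Suc.prems by (simp_all add: M_def)
    define p where "p = truncated_eval (rs_P \<sigma> k) (2 ^ k) x"
    define q where "q = of_int (\<sigma> k) * x ^ 2 ^ k * truncated_eval (rs_Q \<sigma> k) M x"
    have "norm p \<le> sqrt 2 * sqrt (2 ^ k)"
      unfolding p_def by (rule rs_P_complete_bound[OF assms(1,2)])
    moreover have "norm q \<le> (2 + sqrt 2) * sqrt M"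
      unfolding q_def using Suc.IH[OF M(2)] norm_sign_power[OF _ assms(2)] assms(1) by metis
    moreover have "real M \<le> 2 ^ k"
      using M(2) by (metis of_nat_le_iff of_nat_numeral of_nat_power)
    then have "sqrt 2 * sqrt (2 ^ k) + (2 + sqrt 2) * sqrt M \<le> (2 + sqrt 2) * sqrt N"
      using sqrt_step[of M "2 ^ k"] M(1) by simp
    ultimately have "norm p + norm q \<le> (2 + sqrt 2) * sqrt N"
      by linarith
    moreover have "truncated_eval (rs_P \<sigma> (Suc k)) N x = p + q"
      "truncated_eval (rs_Q \<sigma> (Suc k)) N x = p - q"
      using truncated_eval_rs_Suc_high[of k N \<sigma> x] False by (simp_all add: p_def q_def M_def)
    ultimately show ?thesis
      using norm_triangle_ineq[of p q] norm_triangle_ineq4[of p q] by simp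
  qed
qed

lemma rs_partial_sum_eq_truncated_eval:
  assumes "rs_sign_seq \<sigma> \<epsilon>" and "N \<le> 2 ^ k"
  shows "(\<Sum>n=1..N. of_int (\<epsilon> n) * x ^ n) = truncated_eval (rs_P \<sigma> k) N x"
proof -
  have "rs_P \<sigma> k = (\<Sum>n=1..2 ^ k. monom (\<epsilon> n) n)"
    using assms(1) by (simp add: rs_sign_seq_def)
  then have "coeff (rs_P \<sigma> k) n = (if n \<in> {1..2 ^ k} then \<epsilon> n else 0)" for n
    by (simp add: coeff_sum)
  then show ?thesis
    unfolding truncated_eval_def using assms(2)
    by (intro sum.mono_neutral_cong_left) auto
qed

theorem proposition3p1:
  fixes \<sigma> \<epsilon> :: "nat \<Rightarrow> int"
  assumes "\<forall>k. \<sigma> k \<in> {1, -1}"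
    and "rs_sign_seq \<sigma> \<epsilon>"
  shows "root_N_property \<epsilon>"
  unfolding root_N_property_def
proof (intro exI conjI allI impI)
  show "(0::real) < 2 + sqrt 2"
    by (simp add: add_pos_pos)
  fix N :: nat
  have "N \<le> 2 ^ N"
    by (simp add: less_imp_le)
  then have "norm (\<Sum>n=1..N. of_int (\<epsilon> n) * x ^ n) \<le> (2 + sqrt 2) * sqrt N"
    if "norm x = 1" for x :: complex
    using rs_truncation_bound[OF assms(1) that] rs_partial_sum_eq_truncated_eval[OF assms(2)]
    by metis
  moreover have "{x :: complex. norm x = 1} \<noteq> {}"
    using norm_one by blast
  ultimately show "(SUP x\<in>{x :: complex. norm x = 1}. norm (\<Sum>n=1..N. of_int (\<epsilon> n) * x ^ n))
      \<le> (2 + sqrt 2) * sqrt (real N)"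
    by (intro cSUP_least) auto
qed

end
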